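(* Let $B\in\mathrm{M}_3(\mathbb{R})$ be a cluster-cyclic skew-symmetrizable matrix. Let $\mathbf w\in\mathcal T\setminus\{\emptyset\}$ and let $k$ be the last index of $\mathbf w$. (a) There is a unique $s\in\{1,2,3\}\setminus\{k\}$ such that $\varepsilon_s^{\mathbf w}\,\mathrm{sign}(b_{ks}^{\mathbf w})=-1$ and $\varepsilon_k^{\mathbf w}\ne\varepsilon_s^{\mathbf w}$. (b) Let $s$ be the index from (a) and let $t$ be the element of $\{1,2,3\}\setminus\{k,s\}$. Then $(\varepsilon_k^{\mathbf w[s]},\varepsilon_s^{\mathbf w[s]},\varepsilon_t^{\mathbf w[s]})=(-\varepsilon_k^{\mathbf w},-\varepsilon_s^{\mathbf w},\varepsilon_t^{\mathbf w})$ and $(\varepsilon_k^{\mathbf w[t]},\varepsilon_s^{\mathbf w[t]},\varepsilon_t^{\mathbf w[t]})=(\varepsilon_k^{\mathbf w},\varepsilon_s^{\mathbf w},-\varepsilon_t^{\mathbf w})$.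
   Context: A matrix $B=(b_{ij})\in\mathrm{M}_3(\mathbb{R})$ is skew-symmetrizable if $DB$ is skew-symmetric for some $D=\mathrm{diag}(d_1,d_2,d_3)$ with $d_i>0$. Notation: $[a]_+=\max(a,0)$, entrywise on matrices; $J_k$ is diagonal with $k$th entry $-1$ and others $1$; $A^{\bullet k}$ (resp. $A^{k\bullet}$) keeps the $k$th column (resp. row) of $A$ and sets other entries to $0$. Mutation: $\mu_k(B)=(J_k+[-B]_+^{\bullet k})B(J_k+[B]_+^{k\bullet})$. Reduced sequences $\mathbf w=[k_1,\dots,k_r]$ ($k_i\in\{1,2,3\}$, $k_i\neq k_{i+1}$) form the set $\mathcal T$ (including $\emptyset$); $\mathbf w[k]$ appends $k$ if $\mathbf w=\emptyset$ or $k\ne k_r$, and deletes the last entry if $k=k_r$. $B^{\mathbf w}=\mu_{k_r}\cdots\mu_{k_1}(B)=(b_{ij}^{\mathbf w})$. $C$-matrices: $C^\emptyset=I$, $C^{\mathbf w[k]}=C^{\mathbf w}J_k+C^{\mathbf w}[B^{\mathbf w}]_+^{k\bullet}+[-C^{\mathbf w}]_+^{\bullet k}B^{\mathbf w}$, with columns $\mathbf c_i^{\mathbf w}$. $B$ is cyclic if $\mathrm{sign}(B)=\pm\begin{pmatrix}0&-1&1\\1&0&-1\\-1&1&0\end{pmatrix}$ entrywise, and cluster-cyclic if every $B^{\mathbf w}$ is cyclic. For cluster-cyclic $B$ every $C^{\mathbf w}$ is sign-coherent (each column is componentwise $\ge 0$ or $\le 0$) with nonzero columns, and the tropical sign $\varepsilon_i^{\mathbf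 w}\in\{\pm1\}$ is defined by $\varepsilon_i^{\mathbf w}\mathbf c_i^{\mathbf w}\ge\mathbf 0$ componentwise. *)

theory Defs
  imports "HOL-Analysis.Analysis"
begin

text \<open>
  Indices range over the type \<open>3\<close>, whose elements are \<open>1, 2, 3\<close> (with \<open>3 = 0\<close> in this
  type). The entry in row \<open>i\<close> and column \<open>j\<close> of \<open>A :: real^3^3\<close> is \<open>A $ i $ j\<close>.
\<close>

subsection \<open>Matrices\<close>

definition diag_mat :: "real^3 \<Rightarrow> real^3^3" where
  "diag_mat d = (\<chi> i j. if i = j then d $ i else 0)"

definition skew_symmetrizable :: "real^3^3 \<Rightarrow> bool" where
  "skew_symmetrizable B \<longleftrightarrow>
     (\<exists>d :: real^3. (\<forall>i. 0 < d $ i) \<and> transpose (diag_mat d ** B) = - (diag_mat d ** B))"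

definition pos_part :: "real^3^3 \<Rightarrow> real^3^3" where
  "pos_part A = (\<chi> i j. max (A $ i $ j) 0)"

definition J_mat :: "3 \<Rightarrow> real^3^3" where
  "J_mat k = diag_mat (\<chi> i. if i = k then -1 else 1)"

definition keep_col :: "3 \<Rightarrow> real^3^3 \<Rightarrow> real^3^3" where
  "keep_col k A = (\<chi> i j. if j = k then A $ i $ j else 0)"

definition keep_row :: "3 \<Rightarrow> real^3^3 \<Rightarrow> real^3^3" where
  "keep_row k A = (\<chi> i j. if i = k then A $ i $ j else 0)"

definition mutate :: "3 \<Rightarrow> real^3^3 \<Rightarrow> real^3^3" where
  "mutate k B = (J_mat k + keep_col k (pos_part (- B))) ** B ** (J_mat k + keep_row k (pos_part B))"

subsection \<open>Reduced sequences\<close>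

definition reduced_seqs :: "3 list set" where
  "reduced_seqs = {w. \<forall>i. Suc i < length w \<longrightarrow> w ! i \<noteq> w ! Suc i}"

definition seq_move :: "3 list \<Rightarrow> 3 \<Rightarrow> 3 list" where
  "seq_move w k = (if w = [] \<or> k \<noteq> last w then w @ [k] else butlast w)"

subsection \<open>Patterns of \<open>B\<close>- and \<open>C\<close>-matrices\<close>

text \<open>The head of the list is the first mutation performed.\<close>

definition B_mat :: "real^3^3 \<Rightarrow> 3 list \<Rightarrow> real^3^3" where
  "B_mat B w = fold mutate w B"

text \<open>
  On reduced sequences the appending case of the recursion already determines all
  \<open>C\<close>-matrices. The recursion formula also holds in the deleting case
  \<open>seq_move (w @ [k]) k = w\<close>, because for skew-symmetrizable \<open>B\<close> the mutation of the
  pair \<open>(B, C)\<close> in direction \<open>k\<close> is an involution.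
\<close>

function C_mat :: "real^3^3 \<Rightarrow> 3 list \<Rightarrow> real^3^3" where
  "C_mat B [] = mat 1"
| "C_mat B (w @ [k]) =
     C_mat B w ** J_mat k
     + C_mat B w ** keep_row k (pos_part (B_mat B w))
     + keep_col k (pos_part (- C_mat B w)) ** B_mat B w"
proof -
  fix P :: bool and x :: "(real^3^3) \<times> 3 list"
  assume 1: "\<And>B. x = (B, []) \<Longrightarrow> P" and 2: "\<And>B w k. x = (B, w @ [k]) \<Longrightarrow> P"
  obtain B w where "x = (B, w)" by (cases x)
  with 1 2 show P by (cases w rule: rev_cases) auto
qed simp_all
termination
  by (relation "Wellfounded.measure (\<lambda>(B, w). length w)") simp_all

subsection \<open>Cluster-cyclicity and tropical signs\<close>

definition sign_mat :: "real^3^3 \<Rightarrow> real^3^3" where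
  "sign_mat A = (\<chi> i j. sgn (A $ i $ j))"

definition cyclic_pattern :: "real^3^3" where
  "cyclic_pattern = vector [vector [ 0, -1,  1],
                            vector [ 1,  0, -1],
                            vector [-1,  1,  0]]"

definition cyclic :: "real^3^3 \<Rightarrow> bool" where
  "cyclic B \<longleftrightarrow> sign_mat B = cyclic_pattern \<or> sign_mat B = - cyclic_pattern"

definition cluster_cyclic :: "real^3^3 \<Rightarrow> bool" where
  "cluster_cyclic B \<longleftrightarrow> (\<forall>w \<in> reduced_seqs. cyclic (B_mat B w))"

text \<open>
  The order on \<open>real^3\<close> is componentwise. The description is uniquely satisfied exactly
  when the column is nonzero and all its entries are \<open>\<ge> 0\<close> or all are \<open>\<le> 0\<close>.
\<close>

definition trop_sign :: "real^3^3 \<Rightarrow> 3 list \<Rightarrow> 3 \<Rightarrow> real" where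
  "trop_sign B w i = (THE e. e \<in> {1, -1} \<and> 0 \<le> e *\<^sub>R column i (C_mat B w))"

end

theory Submission
  imports Defs
begin

text \<open>
  Put \<open>p\<^sub>i\<^sub>j = r\<^sub>i \<bar>b\<^sub>i\<^sub>j\<bar> / r\<^sub>j\<close> with \<open>r\<^sub>i\<close> the square root of the \<open>i\<close>-th symmetrizer; this is
  symmetric in \<open>i, j\<close> and cyclicity turns mutation into \<open>p\<^sub>i\<^sub>j \<mapsto> p\<^sub>i\<^sub>k p\<^sub>k\<^sub>j - p\<^sub>i\<^sub>j\<close>. All \<open>p\<^sub>i\<^sub>j\<close>
  stay positive under alternating mutations, which forces \<open>p\<^sub>i\<^sub>j \<ge> 2\<close>. Sign-coherence and the
  shape of the signs are then proved together by induction on the sequence, with the invariant that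
  columns \<open>k\<close> and \<open>s\<close> have opposite signs and \<open>\<bar>c\<^sub>k\<bar> / r\<^sub>k \<le> \<bar>c\<^sub>s\<bar> / r\<^sub>s\<close>. Mutation at \<open>s\<close> replaces the
  normalized pair \<open>(x, y)\<close> of these absolute values by \<open>(y, p y - x)\<close>, and \<open>p \<ge> 2\<close> gives
  \<open>p y - x \<ge> y\<close>; mutation at \<open>t\<close> adds a multiple \<open>\<ge> 2\<close> of column \<open>t\<close> to a column of the same sign.
\<close>

section \<open>Sign patterns of cyclic matrices and their mutation\<close>

text \<open>Both cyclic patterns have constant sign around the 3-cycle, so later sign arguments need
  not fix a numbering of the indices or an orientation.\<close>

lemma cyclic_entries:
  assumes "cyclic A" "i \<noteq> j" "j \<noteq> l" "i \<noteq> l"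
  shows "A $ i $ i = 0" "A $ i $ j \<noteq> 0"
    "sgn (A $ j $ i) = - sgn (A $ i $ j)" "sgn (A $ j $ l) = sgn (A $ i $ j)"
proof -
  have "A $ i $ i = 0 \<and> A $ i $ j \<noteq> 0 \<and> sgn (A $ j $ i) = - sgn (A $ i $ j)
      \<and> sgn (A $ j $ l) = sgn (A $ i $ j)"
    using assms exhaust_3[of i] exhaust_3[of j] exhaust_3[of l]
    unfolding cyclic_def sign_mat_def cyclic_pattern_def
    by (auto simp: vec_eq_iff forall_3 sgn_if split: if_splits)
  then show "A $ i $ i = 0" "A $ i $ j \<noteq> 0"
    "sgn (A $ j $ i) = - sgn (A $ i $ j)" "sgn (A $ j $ l) = sgn (A $ i $ j)"
    by auto
qed

lemma third_index: obtains l :: 3 where "l \<noteq> i" "l \<noteq> j"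
  using that[of 1] that[of 2] that[of 3] by force

lemma UNIV_3_distinct:
  fixes i j l :: 3
  assumes "i \<noteq> j" "j \<noteq> l" "i \<noteq> l"
  shows "UNIV = {i, j, l}"
  using assms exhaust_3[of i] exhaust_3[of j] exhaust_3[of l] unfolding UNIV_3 by auto

lemma mutate_entries:
  fixes A :: "real^3^3"
  assumes "A $ k $ k = 0"
  shows "mutate k A $ i $ j =
    (if i = k \<or> j = k then - A $ i $ j
     else A $ i $ j + max (- A $ i $ k) 0 * A $ k $ j + A $ i $ k * max (A $ k $ j) 0)"
  using assms exhaust_3[of i] exhaust_3[of j] exhaust_3[of k]
  unfolding mutate_def J_mat_def keep_col_def keep_row_def pos_part_def diag_mat_def
    matrix_matrix_mult_def
  by (elim disjE) (simp_all add: sum_3 algebra_simps)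

text \<open>Cyclicity of \<open>A\<close> makes the correction term and \<open>A $ i $ j\<close>
  opposite in sign. Cyclicity of \<open>mutate k A\<close> gives the new entry the sign of the
  correction, so no outer absolute value remains.\<close>

lemma abs_mutate:
  assumes "cyclic A" "cyclic (mutate k A)" "i \<noteq> j" "j \<noteq> k" "i \<noteq> k"
  shows "\<bar>mutate k A $ i $ j\<bar> = \<bar>A $ i $ k\<bar> * \<bar>A $ k $ j\<bar> - \<bar>A $ i $ j\<bar>"
proof -
  have z: "A $ k $ k = 0" using cyclic_entries(1)[OF assms(1), of k i j] assms by auto
  note m = mutate_entries[OF z]
  have s1: "sgn (A $ k $ j) = sgn (A $ i $ k)"
    using cyclic_entries(4)[OF assms(1), of i k j] assms by auto
  have s2: "sgn (A $ i $ j) = - sgn (A $ i $ k)"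
    using cyclic_entries(4)[OF assms(1), of j i k] cyclic_entries(3)[OF assms(1), of j i k] assms
    by auto
  have s3: "sgn (mutate k A $ i $ j) = - sgn (mutate k A $ i $ k)"
    using cyclic_entries(4)[OF assms(2), of j i k] cyclic_entries(3)[OF assms(2), of j i k] assms
    by auto
  have "mutate k A $ i $ k = - A $ i $ k" by (simp add: m)
  moreover have "mutate k A $ i $ j =
      A $ i $ j + max (- A $ i $ k) 0 * A $ k $ j + A $ i $ k * max (A $ k $ j) 0"
    using assms by (simp add: m)
  moreover have "A $ i $ k \<noteq> 0" using cyclic_entries(2)[OF assms(1), of i k j] assms by auto
  ultimately show ?thesis using s1 s2 s3
    by (cases "A $ i $ k > 0") (auto simp: sgn_if abs_if split: if_splits)
qed

section \<open>Positive solutions of a linear recurrence\<close>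

text \<open>\<open>S\<close> holds consecutive terms, whose second difference is
  \<open>(p - 2) * y\<close>. For \<open>p < 2\<close> the orbit would be positive and strictly
  concave forever, which is impossible.\<close>

lemma positive_recurrence_ge_2:
  fixes p :: real
  assumes S: "\<And>x y. (x, y) \<in> S \<Longrightarrow> 0 < x \<and> (y, p * y - x) \<in> S"
    and xy: "(x, y) \<in> S"
  shows "2 \<le> p"
proof (rule ccontr)
  assume "\<not> 2 \<le> p"
  then have p: "0 < 2 - p" by simp
  \<comment> \<open>By concavity a drop \<open>x - y\<close> recurs at least as large at each later
    step, while the terms stay positive.\<close>
  have dec: "real n * (x - y) \<le> x" if "(x, y) \<in> S" for n x y
    using that
  proof (induction n arbitrary: x y)
    case 0
    then show ?case using S by force
  next
    case (Suc n)
    have y: "0 < y" and z: "(y, p * y - x) \<in> S" using S Suc.prems by blast+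
    have "real n * (x - y) \<le> real n * (y - (p * y - x))"
      using mult_pos_pos[OF p y] by (intro mult_left_mono) (auto simp: algebra_simps)
    also have "\<dots> \<le> y" by (rule Suc.IH[OF z])
    finally show ?case by (simp add: algebra_simps)
  qed
  have mono: "x \<le> y" if "(x, y) \<in> S" for x y
  proof (rule ccontr)
    assume "\<not> x \<le> y"
    then obtain n where "x < real n * (x - y)" using reals_Archimedean3[of "x - y"] by auto
    then show False using dec[OF that, of n] by simp
  qed
  \<comment> \<open>The increments stay nonnegative by \<open>mono\<close>, yet each step lowers
    them by at least \<open>(2 - p) * x\<close>.\<close>
  have inc: "real n * ((2 - p) * x) \<le> y - x" if "(x, y) \<in> S" for n x y
    using that
  proof (induction n arbitrary: x y)
    case 0
    then show ?case using mono by force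
  next
    case (Suc n)
    have z: "(y, p * y - x) \<in> S" using S Suc.prems by blast
    have "real (Suc n) * ((2 - p) * x) \<le> real (Suc n) * ((2 - p) * y)"
      using p mono[OF Suc.prems] by (intro mult_left_mono) auto
    also have "\<dots> \<le> y - x" using Suc.IH[OF z] by (simp add: algebra_simps)
    finally show ?case .
  qed
  have "0 < (2 - p) * x" using p S[OF xy] by simp
  then obtain n where "y - x < real n * ((2 - p) * x)" using reals_Archimedean3 by blast
  then show False using inc[OF xy, of n] by simp
qed

section \<open>Reduced sequences and sign-coherent columns\<close>

lemma reduced_snoc: "w @ [i] \<in> reduced_seqs \<longleftrightarrow> w \<in> reduced_seqs \<and> (w = [] \<or> last w \<noteq> i)"
proof
  assume a: "w @ [i] \<in> reduced_seqs"
  then have n: "(w @ [i]) ! m \<noteq> (w @ [i]) ! Suc m" if "m < length w" for m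
    using that unfolding reduced_seqs_def by auto
  have "w \<in> reduced_seqs" unfolding reduced_seqs_def
  proof safe
    fix m assume "Suc m < length w" "w ! m = w ! Suc m"
    then show False using n[of m] by (simp add: nth_append)
  qed
  moreover have "last w \<noteq> i" if "w \<noteq> []"
    using n[of "length w - 1"] that by (simp add: nth_append last_conv_nth)
  ultimately show "w \<in> reduced_seqs \<and> (w = [] \<or> last w \<noteq> i)" by blast
next
  assume a: "w \<in> reduced_seqs \<and> (w = [] \<or> last w \<noteq> i)"
  show "w @ [i] \<in> reduced_seqs" unfolding reduced_seqs_def
  proof safe
    fix m assume m: "Suc m < length (w @ [i])" "(w @ [i]) ! m = (w @ [i]) ! Suc m"
    show False
    proof (cases "Suc m < length w")
      case True
      then show False using a m unfolding reduced_seqs_def by (simp add: nth_append)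
    next
      case False
      then have l: "length w = Suc m" using m by simp
      then have "w \<noteq> []" by auto
      then show False using a m l by (simp add: nth_append last_conv_nth)
    qed
  qed
qed

lemma B_mat_snoc: "B_mat B (w @ [k]) = mutate k (B_mat B w)"
  by (simp add: B_mat_def)

text \<open>Nonvanishing of \<open>v\<close> makes \<open>e\<close> unique, as the definite
  description in \<open>trop_sign\<close> requires.\<close>

definition signed :: "real \<Rightarrow> real^3 \<Rightarrow> bool" where
  "signed e v \<longleftrightarrow> e \<in> {1, -1} \<and> v \<noteq> 0 \<and> 0 \<le> e *\<^sub>R v"

lemma trop_sign_eq:
  assumes "signed e (column i (C_mat B w))"
  shows "trop_sign B w i = e"
  unfolding trop_sign_def
proof (rule the_equality)
  show "e \<in> {1, -1} \<and> 0 \<le> e *\<^sub>R column i (C_mat B w)" using assms by (simp add: signed_def)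
next
  fix e' :: real assume "e' \<in> {1, -1} \<and> 0 \<le> e' *\<^sub>R column i (C_mat B w)"
  then show "e' = e" using assms by (auto simp: signed_def)
qed

lemma signed_uminus: "signed (- e) (- v) \<longleftrightarrow> signed e v"
  by (auto simp: signed_def)

lemma signed_add:
  assumes "signed e v" "signed e u" "0 \<le> a"
  shows "signed e (v + a *\<^sub>R u)"
proof -
  have v: "0 \<le> e *\<^sub>R v" and e: "e \<noteq> 0" "v \<noteq> 0"
    using assms by (auto simp: signed_def)
  have u: "0 \<le> a *\<^sub>R e *\<^sub>R u"
    using assms(2) scaleR_nonneg_nonneg[OF assms(3)] unfolding signed_def by blast
  have "e *\<^sub>R (v + a *\<^sub>R u) = e *\<^sub>R v + a *\<^sub>R e *\<^sub>R u" by (simp add: algebra_simps)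
  moreover have "e *\<^sub>R v + a *\<^sub>R e *\<^sub>R u \<noteq> 0"
    using add_nonneg_eq_0_iff[OF v u] e by simp
  ultimately show ?thesis using v u assms(1) by (auto simp: signed_def simp del: scaleR_scaleR)
qed

text \<open>Since column \<open>k\<close> has one sign \<open>e\<close>, the two correction terms of
  the recursion merge: for \<open>e = -1\<close>,
  \<open>max b 0 * c - c * b = max (- b) 0 * c\<close>.\<close>

lemma column_C_mat_snoc:
  assumes z: "B_mat B w $ k $ k = 0" and e: "signed e (column k (C_mat B w))"
  shows "column j (C_mat B (w @ [k])) =
    (if j = k then - column k (C_mat B w)
     else column j (C_mat B w) + max (e * B_mat B w $ k $ j) 0 *\<^sub>R column k (C_mat B w))"
proof -
  define C where "C = C_mat B w"
  define A where "A = B_mat B w"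
  have C: "C_mat B (w @ [k]) = C ** J_mat k + C ** keep_row k (pos_part A)
      + keep_col k (pos_part (- C)) ** A"
    by (simp add: C_def A_def)
  have z': "A $ k $ k = 0" using z by (simp add: A_def)
  have ent: "C_mat B (w @ [k]) $ i $ j = (if j = k then - C $ i $ k
      else C $ i $ j + max (A $ k $ j) 0 * C $ i $ k + max (- C $ i $ k) 0 * A $ k $ j)" for i
    unfolding C using z' exhaust_3[of j] exhaust_3[of k]
    unfolding J_mat_def keep_col_def keep_row_def pos_part_def diag_mat_def
      matrix_matrix_mult_def
    by (elim disjE) (simp_all add: sum_3 algebra_simps)
  have e1: "e = 1 \<or> e = -1" and e2: "0 \<le> e * C $ i $ k" for i
    using e by (auto simp: signed_def less_eq_vec_def column_def C_def)
  have "max (A $ k $ j) 0 * C $ i $ k + max (- C $ i $ k) 0 * A $ k $ j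
      = max (e * A $ k $ j) 0 * C $ i $ k" for i
    using e1 e2[of i] by (auto simp: max_def algebra_simps)
  then show ?thesis
    using ent by (auto simp: vec_eq_iff column_def C_def[symmetric] A_def[symmetric])
qed

section \<open>Normalized weights along the mutation tree\<close>

locale weighted_cluster_cyclic =
  fixes B :: "real^3^3" and r :: "3 \<Rightarrow> real"
  assumes cc: "cluster_cyclic B"
    and r_pos: "0 < r i"
    and r_sym: "(r i)\<^sup>2 * \<bar>B $ i $ j\<bar> = (r j)\<^sup>2 * \<bar>B $ j $ i\<bar>"
begin

definition weight :: "3 list \<Rightarrow> 3 \<Rightarrow> 3 \<Rightarrow> real" where
  "weight w i j = r i * \<bar>B_mat B w $ i $ j\<bar> / r j"

lemma cyclic_B_mat: "w \<in> reduced_seqs \<Longrightarrow> cyclic (B_mat B w)"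
  using cc by (simp add: cluster_cyclic_def)

lemma B_mat_diag: "w \<in> reduced_seqs \<Longrightarrow> B_mat B w $ i $ i = 0"
  using third_index[of i i] third_index[of i] cyclic_entries(1)[OF cyclic_B_mat] by metis

lemma B_mat_snoc_entries:
  "w \<in> reduced_seqs \<Longrightarrow> B_mat B (w @ [k]) $ k $ j = - B_mat B w $ k $ j"
  "w \<in> reduced_seqs \<Longrightarrow> B_mat B (w @ [k]) $ j $ k = - B_mat B w $ j $ k"
  by (simp_all add: B_mat_snoc mutate_entries B_mat_diag)

text \<open>The normalization is compatible with \<open>abs_mutate\<close> because the factors
  \<open>r k\<close> cancel in the product through \<open>k\<close>.\<close>

lemma weight_snoc:
  assumes "w @ [k] \<in> reduced_seqs"
  shows "weight (w @ [k]) k j = weight w k j" "weight (w @ [k]) j k = weight w j k"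
    "i \<noteq> j \<Longrightarrow> j \<noteq> k \<Longrightarrow> i \<noteq> k \<Longrightarrow>
      weight (w @ [k]) i j = weight w i k * weight w k j - weight w i j"
proof -
  have w: "w \<in> reduced_seqs" using assms by (simp add: reduced_snoc)
  show "weight (w @ [k]) k j = weight w k j" "weight (w @ [k]) j k = weight w j k"
    using w by (simp_all add: weight_def B_mat_snoc_entries)
  assume d: "i \<noteq> j" "j \<noteq> k" "i \<noteq> k"
  have eq: "\<bar>B_mat B (w @ [k]) $ i $ j\<bar>
      = \<bar>B_mat B w $ i $ k\<bar> * \<bar>B_mat B w $ k $ j\<bar> - \<bar>B_mat B w $ i $ j\<bar>"
    using abs_mutate[OF cyclic_B_mat[OF w] _ d] cyclic_B_mat[OF assms] by (simp add: B_mat_snoc)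
  show "weight (w @ [k]) i j = weight w i k * weight w k j - weight w i j"
    unfolding weight_def eq using r_pos[of k] r_pos[of j] by (simp add: field_simps)
qed

text \<open>The symmetrizer is needed only for the initial matrix; the recursion of
  \<open>weight_snoc\<close> preserves symmetry.\<close>

lemma weight_sym: "w \<in> reduced_seqs \<Longrightarrow> weight w i j = weight w j i"
proof (induction w arbitrary: i j rule: rev_induct)
  case Nil
  show ?case using r_sym[of i j] r_pos[of i] r_pos[of j]
    by (simp add: weight_def B_mat_def field_simps power2_eq_square)
next
  case (snoc k w)
  then have IH: "weight w i j = weight w j i" for i j by (simp add: reduced_snoc)
  show ?case
    using weight_snoc[OF snoc.prems] IH by (cases "i = j"; cases "i = k"; cases "j = k") simp_all
qed

lemma weight_pos: "w \<in> reduced_seqs \<Longrightarrow> i \<noteq> j \<Longrightarrow> 0 < weight w i j"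
  using third_index[of i j] cyclic_entries(2)[OF cyclic_B_mat] r_pos
  by (smt (verit, best) weight_def zero_less_divide_iff zero_less_mult_iff zero_less_abs_iff)

text \<open>Mutating alternately in directions \<open>i\<close> and \<open>j\<close> keeps \<open>p = weight i j\<close>, and the
  weights towards the third index form a positive solution of \<open>x'' = p x' - x\<close>.\<close>

lemma weight_ge_2:
  assumes "w @ [i] \<in> reduced_seqs" "i \<noteq> j"
  shows "2 \<le> weight w i j"
proof -
  obtain l where l: "l \<noteq> i" "l \<noteq> j" by (rule third_index)
  define p where "p = weight w i j"
  \<comment> \<open>Each pair carries a sequence \<open>u\<close> whose next direction is
    \<open>a\<close>; passing to \<open>u @ [a]\<close> swaps \<open>a\<close> and
    \<open>b\<close>.\<close>
  define S where "S = {(weight u b l, weight u a l) | u a b.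
    u @ [a] \<in> reduced_seqs \<and> a \<noteq> b \<and> a \<noteq> l \<and> b \<noteq> l \<and> weight u a b = p}"
  show ?thesis unfolding p_def[symmetric]
  proof (rule positive_recurrence_ge_2)
    show "(weight w j l, weight w i l) \<in> S" unfolding S_def p_def using assms l by blast
  next
    fix x y assume "(x, y) \<in> S"
    then obtain u a b where x: "x = weight u b l" and y: "y = weight u a l"
      and u: "u @ [a] \<in> reduced_seqs" and d: "a \<noteq> b" "a \<noteq> l" "b \<noteq> l" and p: "weight u a b = p"
      unfolding S_def by blast
    have u': "u \<in> reduced_seqs" using u by (simp add: reduced_snoc)
    have "weight (u @ [a]) b l = p * y - x"
      using weight_snoc(3)[OF u, of b l] d weight_sym[OF u', of b a] p x y by simp
    moreover have "weight (u @ [a]) a l = y" using weight_snoc(1)[OF u] y by simp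
    moreover have "weight (u @ [a]) b a = p"
      using weight_snoc(2)[OF u] weight_sym[OF u', of b a] p by simp
    moreover have "(u @ [a]) @ [b] \<in> reduced_seqs"
      using u d unfolding reduced_snoc[of "u @ [a]"] by simp
    ultimately have "(y, p * y - x) \<in> S" unfolding S_def mem_Collect_eq using d
      by (intro exI[of _ "u @ [a]"] exI[of _ b] exI[of _ a]) auto
    then show "0 < x \<and> (y, p * y - x) \<in> S" using weight_pos[OF u'] x d by auto
  qed
qed

section \<open>Evolution of the columns and their signs\<close>

definition col :: "3 list \<Rightarrow> 3 \<Rightarrow> real^3" where
  "col w i = column i (C_mat B w)"

definition signs :: "3 list \<Rightarrow> (3 \<Rightarrow> real) \<Rightarrow> bool" where
  "signs w g \<longleftrightarrow> (\<forall>i. signed (g i) (col w i))"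

text \<open>The last condition is what makes the sign of column \<open>k\<close> flip under mutation at \<open>s\<close>.\<close>

definition dominated :: "3 list \<Rightarrow> 3 \<Rightarrow> 3 \<Rightarrow> 3 \<Rightarrow> (3 \<Rightarrow> real) \<Rightarrow> bool" where
  "dominated w k s t g \<longleftrightarrow> w \<in> reduced_seqs \<and> w \<noteq> [] \<and> last w = k
     \<and> k \<noteq> s \<and> s \<noteq> t \<and> k \<noteq> t \<and> signs w g \<and> g s = - g k \<and> sgn (B_mat B w $ k $ s) = g k
     \<and> (g k / r k) *\<^sub>R col w k \<le> (g s / r s) *\<^sub>R col w s"

lemma signs_sgn: "signs w g \<Longrightarrow> g i = 1 \<or> g i = -1"
  by (auto simp: signs_def signed_def)

lemma signs_nonneg: "signs w g \<Longrightarrow> 0 \<le> g i *\<^sub>R col w i"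
  by (auto simp: signs_def signed_def)

text \<open>The two off-diagonal entries of row \<open>i\<close> have opposite signs, so only one
  other column changes; the sign condition names it \<open>j\<close>. The coefficient is the
  absolute value of the \<open>i\<close>, \<open>j\<close> entry.\<close>

lemma col_snoc:
  assumes w: "w @ [i] \<in> reduced_seqs" and g: "signs w g"
    and d: "i \<noteq> j" "j \<noteq> l" "i \<noteq> l" and s: "sgn (B_mat B w $ i $ j) = g i"
  shows "col (w @ [i]) i = - col w i" "col (w @ [i]) l = col w l"
    "col (w @ [i]) j = col w j + (weight w i j * r j / r i) *\<^sub>R col w i"
proof -
  have w': "w \<in> reduced_seqs" using w by (simp add: reduced_snoc)
  have e: "signed (g i) (column i (C_mat B w))" using g by (simp add: signs_def col_def)
  note c = column_C_mat_snoc[OF B_mat_diag[OF w'] e, folded col_def]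
  show "col (w @ [i]) i = - col w i" by (simp add: c)
  have "sgn (B_mat B w $ i $ l) = - g i"
    using cyclic_entries(3,4)[OF cyclic_B_mat[OF w'], of l i j] d s by simp
  then have "max (g i * B_mat B w $ i $ l) 0 = 0"
    using signs_sgn[OF g, of i] by (auto simp: sgn_if split: if_splits)
  then show "col (w @ [i]) l = col w l" using d by (simp add: c)
  have "max (g i * B_mat B w $ i $ j) 0 = \<bar>B_mat B w $ i $ j\<bar>"
    by (auto simp: s[symmetric] sgn_if max_def)
  then show "col (w @ [i]) j = col w j + (weight w i j * r j / r i) *\<^sub>R col w i"
    using d r_pos[of i] r_pos[of j] by (simp add: c weight_def)
qed

lemma sgn_B_mat_snoc:
  assumes "w \<in> reduced_seqs"
  shows "sgn (B_mat B (w @ [i]) $ i $ j) = - sgn (B_mat B w $ i $ j)"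
  using assms by (simp add: B_mat_snoc_entries)

text \<open>This creates the invariant without assuming it before: column \<open>j\<close> absorbs a
  multiple of a column of its own sign, large enough to dominate column \<open>i\<close>.\<close>

lemma dominated_snoc_same_sign:
  assumes w: "w @ [i] \<in> reduced_seqs" and g: "signs w g"
    and d: "i \<noteq> j" "j \<noteq> l" "i \<noteq> l" and s: "sgn (B_mat B w $ i $ j) = g i" and eq: "g j = g i"
  shows "dominated (w @ [i]) i j l (g(i := - g i))"
proof -
  have w': "w \<in> reduced_seqs" using w by (simp add: reduced_snoc)
  note c = col_snoc[OF w g d s]
  have p: "2 \<le> weight w i j" by (rule weight_ge_2[OF w d(1)])
  have a: "0 \<le> weight w i j * r j / r i" using p r_pos[of i] r_pos[of j] by simp
  have "signed (g j) (col (w @ [i]) j)"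
    unfolding c(3) using g eq a by (intro signed_add) (auto simp: signs_def, metis)
  then have "signed ((g(i := - g i)) m) (col (w @ [i]) m)" for m
    using g c(1,2) UNIV_3_distinct[OF d] d by (cases "m = i"; cases "m = j")
      (auto simp: signs_def signed_uminus)
  moreover have "(g i / r i) *\<^sub>R col w i \<le> (g j / r j) *\<^sub>R col (w @ [i]) j"
  proof -
    \<comment> \<open>One copy of the normalized column \<open>i\<close> is taken out of the
      \<open>weight w i j\<close> copies added.\<close>
    have "(g j / r j) *\<^sub>R col (w @ [i]) j - (g i / r i) *\<^sub>R col w i
        = (1 / r j) *\<^sub>R g j *\<^sub>R col w j + ((weight w i j - 1) / r i) *\<^sub>R g i *\<^sub>R col w i"
      unfolding c(3) using eq r_pos[of i] r_pos[of j]
      by (simp add: vec_eq_iff field_simps)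
    also have "0 \<le> \<dots>"
      using p r_pos[of i] r_pos[of j]
      by (intro add_nonneg_nonneg scaleR_nonneg_nonneg[OF _ signs_nonneg[OF g]]) auto
    finally show ?thesis by simp
  qed
  ultimately show ?thesis
    unfolding dominated_def signs_def using w d s eq c(1) by (auto simp: sgn_B_mat_snoc[OF w'])
qed

text \<open>Column \<open>k\<close> receives a multiple of column \<open>s\<close>, which has the
  opposite sign; dominance makes the multiple prevail, so \<open>k\<close> flips too and the roles
  of \<open>k\<close> and \<open>s\<close> are exchanged.\<close>

lemma dominated_snoc_s:
  assumes D: "dominated w k s t g"
  shows "dominated (w @ [s]) s k t (g(k := - g k, s := - g s))"
proof -
  have w: "w \<in> reduced_seqs" and d: "k \<noteq> s" "s \<noteq> t" "k \<noteq> t" and g: "signs w g"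
    and gs: "g s = - g k" and b: "sgn (B_mat B w $ k $ s) = g k"
    and le: "(g k / r k) *\<^sub>R col w k \<le> (g s / r s) *\<^sub>R col w s"
    and w': "w @ [s] \<in> reduced_seqs"
    using D by (auto simp: dominated_def reduced_snoc)
  have b': "sgn (B_mat B w $ s $ k) = g s"
    using cyclic_entries(3)[OF cyclic_B_mat[OF w] d] b gs by simp
  note c = col_snoc[OF w' g d(1)[symmetric] d(3) d(2) b']
  define h where "h = g(k := - g k, s := - g s)"
  have h: "h k = g s" "h s = - g s" "h t = g t" using d gs by (auto simp: h_def)
  have p: "2 \<le> weight w s k" using weight_ge_2[OF w'] d by simp
  have dom: "(g s / r s) *\<^sub>R col w s \<le> (g s / r k) *\<^sub>R col (w @ [s]) k"
  proof -
    \<comment> \<open>In normalized terms \<open>(p * y - x) - y = (y - x) + (p - 2) * y\<close>;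
      the full bound 2 enters here.\<close>
    have "(g s / r k) *\<^sub>R col (w @ [s]) k - (g s / r s) *\<^sub>R col w s
      = ((g s / r s) *\<^sub>R col w s - (g k / r k) *\<^sub>R col w k)
        + ((weight w s k - 2) / r s) *\<^sub>R g s *\<^sub>R col w s"
      unfolding c(3) using gs r_pos[of s] r_pos[of k]
      by (simp add: vec_eq_iff field_simps)
    also have "0 \<le> \<dots>"
      using p le r_pos[of s]
      by (intro add_nonneg_nonneg scaleR_nonneg_nonneg[OF _ signs_nonneg[OF g]]) auto
    finally show ?thesis by simp
  qed
  have "signed (g s) (col (w @ [s]) k)"
  proof -
    have gs1: "g s = 1 \<or> g s = -1" using signs_sgn[OF g] .
    have pos: "0 \<le> (g s / r s) *\<^sub>R col w s"
      using signs_nonneg[OF g, of s] r_pos[of s] scaleR_nonneg_nonneg[of "1 / r s" "g s *\<^sub>R col w s"]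
      by simp
    have "col w s \<noteq> 0" using g by (simp add: signs_def signed_def)
    then have nz: "(g s / r s) *\<^sub>R col w s \<noteq> 0" using gs1 r_pos[of s] by auto
    have "0 \<le> (g s / r k) *\<^sub>R col (w @ [s]) k" using pos dom by (rule order_trans)
    then have "0 \<le> r k *\<^sub>R (g s / r k) *\<^sub>R col (w @ [s]) k"
      by (rule scaleR_nonneg_nonneg[OF less_imp_le[OF r_pos]])
    then have "0 \<le> g s *\<^sub>R col (w @ [s]) k" using r_pos[of k] by simp
    \<comment> \<open>Otherwise the nonnegative vector of column \<open>s\<close> would lie below 0
      and vanish.\<close>
    moreover have "col (w @ [s]) k \<noteq> 0"
      using dom pos nz by auto
    ultimately show ?thesis using gs1 by (auto simp: signed_def)
  qed
  then have new_k: "signed (h k) (col (w @ [s]) k)" by (simp add: h)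
  have "signed (h m) (col (w @ [s]) m)" for m
  proof -
    consider "m = k" | "m = s" | "m = t" using UNIV_3_distinct[OF d] by blast
    then show ?thesis
    proof cases
      case 1
      then show ?thesis using new_k by simp
    next
      case 2
      then show ?thesis using g by (simp add: h c(1) signs_def signed_uminus)
    next
      case 3
      then show ?thesis using g by (simp add: h c(2) signs_def)
    qed
  qed
  then have "signs (w @ [s]) h" by (simp add: signs_def)
  moreover have "sgn (B_mat B (w @ [s]) $ s $ k) = h s"
    by (simp add: sgn_B_mat_snoc[OF w] b' h)
  moreover have "(h s / r s) *\<^sub>R col (w @ [s]) s \<le> (h k / r k) *\<^sub>R col (w @ [s]) k"
    using dom by (simp add: h c(1))
  ultimately show ?thesis
    unfolding dominated_def h_def[symmetric] using w' d h by auto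
qed

text \<open>Row \<open>t\<close> has sign \<open>g k\<close> at \<open>k\<close> and
  \<open>g s\<close> at \<open>s\<close>, and \<open>g t\<close> equals one of these. So the column
  that changes always has the sign of column \<open>t\<close>, and becomes the new
  \<open>s'\<close>.\<close>

lemma dominated_snoc_t:
  assumes D: "dominated w k s t g"
  shows "\<exists>s' t'. dominated (w @ [t]) t s' t' (g(t := - g t))"
proof -
  have w: "w \<in> reduced_seqs" and d: "k \<noteq> s" "s \<noteq> t" "k \<noteq> t" and g: "signs w g"
    and gs: "g s = - g k" and b: "sgn (B_mat B w $ k $ s) = g k"
    and w': "w @ [t] \<in> reduced_seqs"
    using D by (auto simp: dominated_def reduced_snoc)
  have tk: "sgn (B_mat B w $ t $ k) = g k"
    using cyclic_entries(4)[OF cyclic_B_mat[OF w], of t k s] d b by simp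
  have ts: "sgn (B_mat B w $ t $ s) = g s"
    using cyclic_entries(3)[OF cyclic_B_mat[OF w], of s t k]
      cyclic_entries(4)[OF cyclic_B_mat[OF w], of k s t] d b gs by simp
  consider "g t = g k" | "g t = g s"
    using signs_sgn[OF g, of t] signs_sgn[OF g, of k] gs by auto
  then show ?thesis
  proof cases
    case 1
    then show ?thesis using dominated_snoc_same_sign[OF w' g d(3)[symmetric] d(1) d(2)[symmetric]] tk by metis
  next
    case 2
    then show ?thesis
      using dominated_snoc_same_sign[OF w' g d(2)[symmetric] d(1)[symmetric] d(3)[symmetric]] ts
      by metis
  qed
qed

text \<open>All columns of the identity have sign 1, and exactly one off-diagonal entry in row
  \<open>k\<close> is positive; its index serves as \<open>s\<close>.\<close>

lemma dominated_singleton: "\<exists>s t g. dominated [k] k s t g"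
proof -
  obtain a where a: "a \<noteq> k" using third_index by blast
  obtain b where b: "b \<noteq> k" "b \<noteq> a" by (rule third_index)
  have nil: "[] \<in> reduced_seqs" and w: "[] @ [k] \<in> reduced_seqs" by (auto simp: reduced_seqs_def)
  have g: "signs [] (\<lambda>_. 1)"
    by (auto simp: signs_def signed_def col_def column_def mat_def vec_eq_iff less_eq_vec_def)
  note cy = cyclic_entries[OF cyclic_B_mat[OF nil]]
  have "sgn (B_mat B [] $ k $ b) = - sgn (B_mat B [] $ k $ a)"
    using cy(3,4)[of a k b] a b by simp
  then consider "sgn (B_mat B [] $ k $ a) = 1" | "sgn (B_mat B [] $ k $ b) = 1"
    using cy(2)[of k a b] a b by (auto simp: sgn_if split: if_splits)
  then show ?thesis
  proof cases
    case 1
    then show ?thesis using dominated_snoc_same_sign[OF w g, of a b] a b by auto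
  next
    case 2
    then show ?thesis using dominated_snoc_same_sign[OF w g, of b a] a b by auto
  qed
qed

lemma dominated_exists:
  assumes "w \<in> reduced_seqs" "w \<noteq> []"
  shows "\<exists>s t g. dominated w (last w) s t g"
  using assms
proof (induction w rule: rev_induct)
  case (snoc i w)
  show ?case
  proof (cases "w = []")
    case True
    then show ?thesis using dominated_singleton by simp
  next
    case False
    then obtain s t g where D: "dominated w (last w) s t g"
      using snoc by (auto simp: reduced_snoc)
    have "i \<noteq> last w" using snoc.prems False by (auto simp: reduced_snoc)
    then have "i = s \<or> i = t"
      using UNIV_3_distinct[of "last w" s t] D unfolding dominated_def by blast
    then show ?thesis using dominated_snoc_s[OF D] dominated_snoc_t[OF D] by auto
  qed
qed simp

lemma dominated_trop_sign: "dominated w k s t g \<Longrightarrow> trop_sign B w i = g i"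
  by (simp add: dominated_def signs_def col_def trop_sign_eq)

end

section \<open>From the symmetrizer to the theorem\<close>

lemma skew_symmetrizable_weights:
  assumes "skew_symmetrizable B"
  obtains r :: "3 \<Rightarrow> real" where "\<And>i. 0 < r i"
    "\<And>i j. (r i)\<^sup>2 * \<bar>B $ i $ j\<bar> = (r j)\<^sup>2 * \<bar>B $ j $ i\<bar>"
proof -
  obtain d :: "real^3" where d: "\<And>i. 0 < d $ i"
    and eq: "transpose (diag_mat d ** B) = - (diag_mat d ** B)"
    using assms unfolding skew_symmetrizable_def by blast
  have ent: "(diag_mat d ** B) $ i $ j = d $ i * B $ i $ j" for i j
    using exhaust_3[of i] by (auto simp: diag_mat_def matrix_matrix_mult_def sum_3)
  have "d $ i * \<bar>B $ i $ j\<bar> = d $ j * \<bar>B $ j $ i\<bar>" for i j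
  proof -
    have "d $ j * B $ j $ i = - (d $ i * B $ i $ j)"
      using arg_cong[OF eq, of "\<lambda>A. A $ i $ j"]
      unfolding transpose_def by (simp only: vec_lambda_beta vector_uminus_component ent)
    then have "\<bar>d $ j * B $ j $ i\<bar> = \<bar>d $ i * B $ i $ j\<bar>" by simp
    then show ?thesis using d[of i] d[of j] by (simp add: abs_mult)
  qed
  then show thesis using d by (intro that[of "\<lambda>i. sqrt (d $ i)"]) (simp_all add: less_imp_le)
qed

theorem theorem3p4:
  fixes B :: "real^3^3" and w :: "3 list" and k :: 3
  assumes "skew_symmetrizable B"
    and "cluster_cyclic B"
    and "w \<in> reduced_seqs - {[]}"
    and "k = last w"
  shows "(\<exists>!s. s \<in> {1, 2, 3} - {k}
             \<and> trop_sign B w s * sgn (B_mat B w $ k $ s) = -1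
             \<and> trop_sign B w k \<noteq> trop_sign B w s)
    \<and> (\<forall>s t. s \<in> {1, 2, 3} - {k}
             \<and> trop_sign B w s * sgn (B_mat B w $ k $ s) = -1
             \<and> trop_sign B w k \<noteq> trop_sign B w s
             \<and> t \<in> {1, 2, 3} - {k, s} \<longrightarrow>
          (trop_sign B (seq_move w s) k, trop_sign B (seq_move w s) s, trop_sign B (seq_move w s) t)
            = (- trop_sign B w k, - trop_sign B w s, trop_sign B w t)
        \<and> (trop_sign B (seq_move w t) k, trop_sign B (seq_move w t) s, trop_sign B (seq_move w t) t)
            = (trop_sign B w k, trop_sign B w s, - trop_sign B w t))"
proof -
  obtain r :: "3 \<Rightarrow> real" where "\<And>i. 0 < r i"
    and "\<And>i j. (r i)\<^sup>2 * \<bar>B $ i $ j\<bar> = (r j)\<^sup>2 * \<bar>B $ j $ i\<bar>"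
    using skew_symmetrizable_weights[OF assms(1)] by blast
  then interpret weighted_cluster_cyclic B r using assms(2) by unfold_locales
  obtain s t g where D: "dominated w k s t g" using dominated_exists assms(3,4) by blast
  have w: "w \<in> reduced_seqs" and d: "k \<noteq> s" "s \<noteq> t" "k \<noteq> t" and g: "signs w g"
    and gs: "g s = - g k" and b: "sgn (B_mat B w $ k $ s) = g k"
    using D by (auto simp: dominated_def)
  obtain s' t' where Dt: "dominated (w @ [t]) t s' t' (g(t := - g t))"
    using dominated_snoc_t[OF D] by blast
  note ts = dominated_trop_sign[OF D] dominated_trop_sign[OF Dt]
    dominated_trop_sign[OF dominated_snoc_s[OF D]]
  \<comment> \<open>Both directions differ from the last index \<open>k\<close>, so neither move
    deletes.\<close>
  have mv: "seq_move w s = w @ [s]" "seq_move w t = w @ [t]"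
    using d assms(4) by (auto simp: seq_move_def)
  have kt: "sgn (B_mat B w $ k $ t) = - g k"
    using cyclic_entries(3,4)[OF cyclic_B_mat[OF w], of t k s] d b by simp
  have U: "{1, 2, 3} = {k, s, t}" using UNIV_3_distinct[OF d] UNIV_3 by simp
  have gk: "g k = 1 \<or> g k = -1" using signs_sgn[OF g] .
  \<comment> \<open>For \<open>x = t\<close> the product condition reads
    \<open>- g t * g k = -1\<close>, forcing \<open>g t = g k\<close> against the last
    condition.\<close>
  have char: "x = s" if "x \<in> {k, s, t} - {k}"
    "trop_sign B w x * sgn (B_mat B w $ k $ x) = -1" "trop_sign B w k \<noteq> trop_sign B w x" for x
    using that kt gk signs_sgn[OF g, of t] by (auto simp: ts)
  have s_ok: "s \<in> {k, s, t} - {k}" "trop_sign B w s * sgn (B_mat B w $ k $ s) = -1"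
    "trop_sign B w k \<noteq> trop_sign B w s"
    using d gs b gk by (auto simp: ts)
  show ?thesis unfolding U
  proof (intro conjI allI impI)
    show "\<exists>!s'. s' \<in> {k, s, t} - {k} \<and> trop_sign B w s' * sgn (B_mat B w $ k $ s') = -1
        \<and> trop_sign B w k \<noteq> trop_sign B w s'"
      using s_ok char by blast
  next
    fix x y
    assume A: "x \<in> {k, s, t} - {k} \<and> trop_sign B w x * sgn (B_mat B w $ k $ x) = -1
        \<and> trop_sign B w k \<noteq> trop_sign B w x \<and> y \<in> {k, s, t} - {k, x}"
    then have x: "x = s" and y: "y = t" using char by blast+
    show "(trop_sign B (seq_move w x) k, trop_sign B (seq_move w x) x, trop_sign B (seq_move w x) y)
        = (- trop_sign B w k, - trop_sign B w x, trop_sign B w y)"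
      unfolding x y mv ts using d by simp
    show "(trop_sign B (seq_move w y) k, trop_sign B (seq_move w y) x, trop_sign B (seq_move w y) y)
        = (trop_sign B w k, trop_sign B w x, - trop_sign B w y)"
      unfolding x y mv ts using d by simp
  qed
qed

end
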